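(* Let $T_2$ be the connected infinite directed $2$-regular graph (vertex set $\mathbb{Z}$, origin $0$, and $(x,y)$ an edge iff $|x-y|=1$), and let ${\bf p}=(p_0,p_1,p_2)$ with $p_i\ge 0$ and $p_0+p_1+p_2=1$. If $p_2\neq 1$, then $$\chi(T_2,{\bf p})=\frac{8(1+p_0)}{(2p_0+p_1)^2}-3\qquad\text{and}\qquad \tilde{\chi}(T_2,{\bf p})=\frac{(2p_2+p_1)^2}{2(1-p_2)}+1 .$$
   Context: For $x\in\mathbb{Z}$ let $L_x=\{x-1,x+1\}$. Configurations are $\omega\in\Omega=\prod_{x\in\mathbb{Z}}2^{L_x}$, where $2^{L_x}$ is the power set, with the $\sigma$-field generated by finite-dimensional cylinders; $P_{\bf p}$ is the product measure under which the states $\omega(x)\subset L_x$, $x\in\mathbb{Z}$, are independent with $P_{\bf p}(\omega(x)=S)=p_{|S|}/\binom{2}{|S|}$ for each $S\subset L_x$. Put $E_\omega=\{(x,y): y\in\omega(x)\}$. Vertices $x,y$ are weakly connected if $x=y$ or there are $x=z_0,z_1,\dots,z_m=y$ such that for each $i$, $(z_i,z_{i+1})\in E_\omega$ or $(z_{i+1},z_i)\in E_\omega$; they are strongly connected if $x=y$ or there is such a sequence with both $(z_i,z_{i+1})\in E_\omega$ and $(z_{i+1},z_i)\in E_\omega$ for each $i$. $|C|$ (resp. $|\tilde C|$) is the number of vertices weakly (resp. strongly) connected to the origin $0$; $\chi(T_2,{\bf p})=\mathbb{E}_{\bf p}(|C|)$ and $\tilde\chi(T_2,{\bf p})=\mathbb{E}_{\bf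 p}(|\tilde C|)$. *)

theory Defs
  imports "HOL-Probability.Probability"
begin

definition nbrs :: "int \<Rightarrow> int set" where
  "nbrs x = {x - 1, x + 1}"

text \<open>A state of the vertex \<open>x\<close> is a set \<open>S \<subseteq> nbrs x\<close>: first its size \<open>k\<close> is drawn with
  probability \<open>p k\<close>, then \<open>S\<close> is uniform among the subsets of that size.  Only
  \<open>p 0\<close>, \<open>p 1\<close>, \<open>p 2\<close> matter.\<close>

definition site_measure :: "(nat \<Rightarrow> real) \<Rightarrow> int \<Rightarrow> int set measure" where
  "site_measure p x =
     point_measure (Pow (nbrs x)) (\<lambda>S. ennreal (p (card S) / real (2 choose card S)))"

text \<open>The space of this measure is \<open>PiE UNIV (\<lambda>x. Pow (nbrs x))\<close>; its \<open>\<sigma>\<close>-algebra is generated by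
  the finite-dimensional cylinders.  It is a product of probability measures as soon as
  \<open>p 0\<close>, \<open>p 1\<close>, \<open>p 2\<close> are nonnegative and sum to 1.\<close>

definition config_measure :: "(nat \<Rightarrow> real) \<Rightarrow> (int \<Rightarrow> int set) measure" where
  "config_measure p = PiM UNIV (site_measure p)"

definition out_edges :: "(int \<Rightarrow> int set) \<Rightarrow> (int \<times> int) set" where
  "out_edges \<omega> = {(x, y). y \<in> \<omega> x}"

definition weakly_connected :: "(int \<Rightarrow> int set) \<Rightarrow> int \<Rightarrow> int \<Rightarrow> bool" where
  "weakly_connected \<omega> x y \<longleftrightarrow> (x, y) \<in> (out_edges \<omega> \<union> (out_edges \<omega>)\<inverse>)\<^sup>*"

text \<open>Strong connection asks for a path each of whose steps is open in both directions, not for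
  a directed path each way.\<close>

definition strongly_connected :: "(int \<Rightarrow> int set) \<Rightarrow> int \<Rightarrow> int \<Rightarrow> bool" where
  "strongly_connected \<omega> x y \<longleftrightarrow> (x, y) \<in> (out_edges \<omega> \<inter> (out_edges \<omega>)\<inverse>)\<^sup>*"

definition weak_cluster :: "(int \<Rightarrow> int set) \<Rightarrow> int set" where
  "weak_cluster \<omega> = {y. weakly_connected \<omega> 0 y}"

definition strong_cluster :: "(int \<Rightarrow> int set) \<Rightarrow> int set" where
  "strong_cluster \<omega> = {y. strongly_connected \<omega> 0 y}"

text \<open>Cluster sizes are measured by counting measure, so that an infinite cluster has size
  \<open>\<infinity>\<close> (\<open>card\<close> would give 0).\<close>

definition weak_susceptibility :: "(nat \<Rightarrow> real) \<Rightarrow> ennreal" where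
  "weak_susceptibility p =
     (\<integral>\<^sup>+ \<omega>. emeasure (count_space UNIV) (weak_cluster \<omega>) \<partial>config_measure p)"

definition strong_susceptibility :: "(nat \<Rightarrow> real) \<Rightarrow> ennreal" where
  "strong_susceptibility p =
     (\<integral>\<^sup>+ \<omega>. emeasure (count_space UNIV) (strong_cluster \<omega>) \<partial>config_measure p)"

end

theory Submission
  imports Defs
begin

text \<open>Along a ray from the origin, the probabilities that the first \<open>n\<close> edges are open and that the
  last vertex does (\<open>v\<close>) or does not (\<open>w\<close>) point forward satisfy a linear recurrence, because the
  next vertex is independent of the earlier ones.  With \<open>\<alpha>\<close>, \<open>\<beta>\<close> chosen such that
  \<open>\<alpha> v + \<beta> w\<close> decreases by exactly \<open>v + w\<close> in each step, the sum over \<open>n\<close> telescopes.  The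
  susceptibility is the sum over both rays, with the origin counted once.\<close>

section \<open>General facts: product measures, series, counting and paths on the integers\<close>

text \<open>\<open>PiM I M\<close> is the image of \<open>M i\<close> times the product over the
  other indices under updating coordinate \<open>i\<close>. An event that ignores this coordinate
  pulls back to a cylinder, so the intersection pulls back to a rectangle.\<close>

lemma emeasure_PiM_indep_coordinate:
  assumes M: "\<And>j. j \<in> I \<Longrightarrow> prob_space (M j)"
    and i: "i \<in> I" and T: "T \<in> sets (M i)" and A: "A \<in> sets (PiM I M)"
    and inv: "\<And>f x. f \<in> A \<Longrightarrow> x \<in> space (M i) \<Longrightarrow> f(i := x) \<in> A"
  shows "emeasure (PiM I M) ({\<omega> \<in> space (PiM I M). \<omega> i \<in> T} \<inter> A)
    = emeasure (M i) T * emeasure (PiM I M) A"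
proof -
  let ?J = "I - {i}"
  interpret Mi: prob_space "M i" using M i by auto
  interpret J: prob_space "PiM ?J M" using M by (intro prob_space_PiM) auto
  obtain x0 where x0: "x0 \<in> space (M i)" using Mi.not_empty by auto
  \<comment> \<open>\<open>B\<close> is the section of \<open>A\<close> over the reference value
    \<open>x0\<close>; by \<open>inv\<close> every other value at \<open>i\<close> gives the same
    section.\<close>
  define B where "B = (\<lambda>X. X(i := x0)) -` A \<inter> space (PiM ?J M)"
  have ins: "insert i ?J = I" using i by auto
  have upd: "(\<lambda>(x, X). X(i := x)) \<in> measurable (M i \<Otimes>\<^sub>M PiM ?J M) (PiM I M)"
    using i unfolding split_beta' by (intro measurable_fun_upd[of I ?J i]) auto
  have updc: "(\<lambda>X. X(i := x0)) \<in> measurable (PiM ?J M) (PiM I M)"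
    using measurable_compose[OF measurable_Pair1'[OF x0] upd] by simp
  have B: "B \<in> sets (PiM ?J M)" unfolding B_def using updc A by (rule measurable_sets)
  have iff: "X(i := x) \<in> A \<longleftrightarrow> X(i := x0) \<in> A" if "x \<in> space (M i)" for x X
    using inv[of "X(i := x)" x0] inv[of "X(i := x0)" x] that x0 by auto
  have *: "emeasure (PiM I M) ({\<omega> \<in> space (PiM I M). \<omega> i \<in> S} \<inter> A)
    = emeasure (M i) S * emeasure (PiM ?J M) B" if S: "S \<in> sets (M i)" for S
  proof -
    have S': "{\<omega> \<in> space (PiM I M). \<omega> i \<in> S} \<inter> A \<in> sets (PiM I M)"
      using i S A by (intro sets.Int sets_Collect_single) auto
    have "emeasure (PiM I M) ({\<omega> \<in> space (PiM I M). \<omega> i \<in> S} \<inter> A)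
      = emeasure (distr (M i \<Otimes>\<^sub>M PiM ?J M) (PiM I M) (\<lambda>(x, X). X(i := x)))
          ({\<omega> \<in> space (PiM I M). \<omega> i \<in> S} \<inter> A)"
      using distr_pair_PiM_eq_PiM[of ?J M i] M i unfolding ins by simp
    also have "\<dots> = emeasure (M i \<Otimes>\<^sub>M PiM ?J M) ((\<lambda>(x, X). X(i := x)) -`
        ({\<omega> \<in> space (PiM I M). \<omega> i \<in> S} \<inter> A) \<inter> space (M i \<Otimes>\<^sub>M PiM ?J M))"
      by (rule emeasure_distr[OF upd S'])
    also have "(\<lambda>(x, X). X(i := x)) -`
        ({\<omega> \<in> space (PiM I M). \<omega> i \<in> S} \<inter> A) \<inter> space (M i \<Otimes>\<^sub>M PiM ?J M) = S \<times> B"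
      using sets.sets_into_space[OF S] sets.sets_into_space[OF A] iff
      unfolding B_def space_pair_measure by (auto dest: subsetD)
    also have "emeasure (M i \<Otimes>\<^sub>M PiM ?J M) (S \<times> B) = emeasure (M i) S * emeasure (PiM ?J M) B"
      using S B by (rule J.emeasure_pair_measure_Times)
    finally show ?thesis .
  qed
  \<comment> \<open>Taking the whole space of \<open>M i\<close> for \<open>S\<close> identifies the
    measure of the section \<open>B\<close> with that of \<open>A\<close>.\<close>
  have "{\<omega> \<in> space (PiM I M). \<omega> i \<in> space (M i)} \<inter> A = A"
    using sets.sets_into_space[OF A] i by (auto simp: space_PiM)
  with *[OF sets.top] have "emeasure (PiM I M) A = emeasure (PiM ?J M) B"
    by (simp add: Mi.emeasure_space_1)
  with *[OF T] show ?thesis by simp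
qed

text \<open>Telescoping and nonnegativity bound the partial sums by the initial potential. Hence
  \<open>v + w\<close> is summable, \<open>v\<close> and \<open>w\<close> tend to 0, and so does the
  potential: nothing is left over in the limit. No estimate on the eigenvalues of the recurrence is
  required.\<close>

lemma sums_telescoping_potential:
  fixes v w :: "nat \<Rightarrow> real"
  assumes nonneg: "\<And>n. v n \<ge> 0" "\<And>n. w n \<ge> 0" "\<alpha> \<ge> 0" "\<beta> \<ge> 0"
    and step: "\<And>n. v n + w n = (\<alpha> * v n + \<beta> * w n) - (\<alpha> * v (Suc n) + \<beta> * w (Suc n))"
  shows "(\<lambda>n. v n + w n) sums (\<alpha> * v 0 + \<beta> * w 0)"
proof -
  let ?f = "\<lambda>n. \<alpha> * v n + \<beta> * w n"
  have "summable (\<lambda>n. v n + w n)"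
  proof (rule summableI_nonneg_bounded)
    fix n
    have "(\<Sum>i<n. v i + w i) = ?f 0 - ?f n"
      by (subst step) (rule sum_lessThan_telescope')
    then show "(\<Sum>i<n. v i + w i) \<le> ?f 0"
      using mult_nonneg_nonneg[OF nonneg(3) nonneg(1)] mult_nonneg_nonneg[OF nonneg(4) nonneg(2)]
      by (smt (verit))
  qed (simp add: nonneg)
  then have lim: "(\<lambda>n. v n + w n) \<longlonglongrightarrow> 0" by (rule summable_LIMSEQ_zero)
  have v: "v \<longlonglongrightarrow> 0" by (rule real_tendsto_sandwich[OF _ _ tendsto_const lim]) (auto simp: nonneg)
  have w: "w \<longlonglongrightarrow> 0" by (rule real_tendsto_sandwich[OF _ _ tendsto_const lim]) (auto simp: nonneg)
  have "?f \<longlonglongrightarrow> \<alpha> * 0 + \<beta> * 0" by (intro tendsto_intros v w)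
  then have "(\<lambda>n. ?f n - ?f (Suc n)) sums (?f 0 - 0)"
    using telescope_sums'[of ?f 0] by simp
  then show ?thesis using step by simp
qed

text \<open>The integers split into the ray from 0 upwards and the ray from -1 downwards; the shift
  by \<open>Suc\<close> keeps the origin out of the second one.\<close>

lemma emeasure_count_space_int:
  "emeasure (count_space UNIV) C =
    (\<Sum>n. indicator C (int n)) + (\<Sum>n. indicator C (- int (Suc n)) :: ennreal)"
proof -
  define N where "N = range (\<lambda>n. - int (Suc n))"
  have U: "range int \<union> N = UNIV"
  proof (intro equalityI subsetI UNIV_I)
    fix x :: int
    show "x \<in> range int \<union> N" by (cases x) (auto simp: N_def)
  qed
  have D: "range int \<inter> N = {}" by (auto simp: N_def)
  have "emeasure (count_space UNIV) C
      = (\<integral>\<^sup>+x. indicator C x * indicator (range int \<union> N) x \<partial>count_space UNIV)"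
    unfolding U by simp
  also have "\<dots> = (\<integral>\<^sup>+x. indicator C x \<partial>count_space (range int))
      + (\<integral>\<^sup>+x. indicator C x \<partial>count_space N)"
    using nn_integral_disjoint_pair_countspace[OF D, of "indicator C"]
    by (simp add: nn_integral_count_space_indicator N_def)
  also have "(\<integral>\<^sup>+x. indicator C x \<partial>count_space (range int))
      = (\<integral>\<^sup>+n. indicator C (int n) \<partial>count_space UNIV)"
    by (rule nn_integral_bij_count_space[symmetric]) (auto intro: inj_on_imp_bij_betw simp: inj_on_def)
  also have "(\<integral>\<^sup>+x. indicator C x \<partial>count_space N)
      = (\<integral>\<^sup>+n. indicator C (- int (Suc n)) \<partial>count_space UNIV)"
    unfolding N_def
    by (rule nn_integral_bij_count_space[symmetric]) (auto intro: inj_on_imp_bij_betw simp: inj_on_def)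
  finally show ?thesis by (simp add: nn_integral_count_space_nat)
qed

text \<open>Steps have length one, so a walk from 0 to \<open>d * int n\<close> cannot jump over an
  edge in between and must cross it in the outward direction. The sign \<open>d\<close> treats both
  rays at once, and \<open>R\<close> may be asymmetric.\<close>

lemma rtrancl_nearest_neighbour_iff:
  fixes R :: "(int \<times> int) set" and d :: int
  assumes R: "\<And>x y. (x, y) \<in> R \<Longrightarrow> \<bar>x - y\<bar> = 1" and d: "\<bar>d\<bar> = 1"
  shows "(0, d * int n) \<in> R\<^sup>* \<longleftrightarrow> (\<forall>k<n. (d * int k, d * int k + d) \<in> R)"
proof
  assume "\<forall>k<n. (d * int k, d * int k + d) \<in> R"
  then show "(0, d * int n) \<in> R\<^sup>*"
    by (induction n) (auto simp: algebra_simps intro: rtrancl_into_rtrancl)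
next
  assume reach: "(0, d * int n) \<in> R\<^sup>*"
  have dd: "d * d = 1" using d by (auto simp: abs_if split: if_splits)
  show "\<forall>k<n. (d * int k, d * int k + d) \<in> R"
  proof (rule ccontr)
    assume "\<not> ?thesis"
    then obtain k where k: "k < n" "(d * int k, d * int k + d) \<notin> R" by auto
    \<comment> \<open>Without the outward edge at \<open>k\<close>, the half-line up to
      \<open>d * int k\<close> cannot be left.\<close>
    have "d * y \<le> int k" if "(0, y) \<in> R\<^sup>*" for y
      using that
    proof (induction rule: rtrancl_induct)
      case (step y z)
      have "\<bar>y - z\<bar> = 1" using R step by auto
      then have yz: "z = y + d \<or> z = y - d" using d by auto
      show ?case
      proof (rule ccontr)
        assume gt: "\<not> d * z \<le> int k"
        then have "d * y = int k" "z = y + d" using yz step.IH dd by (auto simp: algebra_simps)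
        then have "y = d * int k" using dd by (metis mult.assoc mult_1)
        then show False using k step \<open>z = y + d\<close> by simp
      qed
    qed simp
    from this[OF reach] show False using k dd by (simp flip: mult.assoc)
  qed
qed

text \<open>The connective \<open>c\<close> says how the two directed edges between neighbours combine: disjunction
  for weak and conjunction for strong connection.\<close>

definition link :: "(bool \<Rightarrow> bool \<Rightarrow> bool) \<Rightarrow> (int \<Rightarrow> int set) \<Rightarrow> (int \<times> int) set" where
  "link c \<omega> = {(x, y). c (y \<in> \<omega> x) (x \<in> \<omega> y)}"

section \<open>Both kinds of cluster as reachability, and rays from the origin\<close>

lemma weak_cluster_link: "weak_cluster \<omega> = {y. (0, y) \<in> (link (\<or>) \<omega>)\<^sup>*}"
proof -
  have "out_edges \<omega> \<union> (out_edges \<omega>)\<inverse> = link (\<or>) \<omega>" by (auto simp: link_def out_edges_def)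
  then show ?thesis by (simp add: weak_cluster_def weakly_connected_def)
qed

lemma strong_cluster_link: "strong_cluster \<omega> = {y. (0, y) \<in> (link (\<and>) \<omega>)\<^sup>*}"
proof -
  have "out_edges \<omega> \<inter> (out_edges \<omega>)\<inverse> = link (\<and>) \<omega>" by (auto simp: link_def out_edges_def)
  then show ?thesis by (simp add: strong_cluster_def strongly_connected_def)
qed

text \<open>For nearest-neighbour links this is the event that \<open>d * int n\<close> lies in the
  cluster of the origin, written as a finite conjunction so that measurability is immediate.\<close>

definition ray_open :: "(bool \<Rightarrow> bool \<Rightarrow> bool) \<Rightarrow> int \<Rightarrow> nat \<Rightarrow> (int \<Rightarrow> int set) \<Rightarrow> bool" where
  "ray_open c d n \<omega> \<longleftrightarrow> (\<forall>k<n. (d * int k, d * int k + d) \<in> link c \<omega>)"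

lemma ray_open_0 [simp]: "ray_open c d 0 \<omega>"
  by (simp add: ray_open_def)

lemma ray_open_Suc: "ray_open c d (Suc n) \<omega> \<longleftrightarrow>
    ray_open c d n \<omega> \<and> (d * int n, d * int n + d) \<in> link c \<omega>"
  by (auto simp: ray_open_def less_Suc_eq)

text \<open>The probability that a site is in a state satisfying \<open>P\<close>, where \<open>P\<close> is given the forward and
  the backward bit; it does not depend on which direction is called forward.\<close>

definition state_weight :: "(nat \<Rightarrow> real) \<Rightarrow> (bool \<Rightarrow> bool \<Rightarrow> bool) \<Rightarrow> real" where
  "state_weight p P = (if P True True then p 2 else 0) + (if P True False then p 1 / 2 else 0)
    + (if P False True then p 1 / 2 else 0) + (if P False False then p 0 else 0)"

section \<open>The law of one site and its independence from the other sites\<close>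

locale site_percolation =
  fixes p :: "nat \<Rightarrow> real"
  assumes nonneg: "p 0 \<ge> 0" "p 1 \<ge> 0" "p 2 \<ge> 0" and total: "p 0 + p 1 + p 2 = 1"
begin

lemma emeasure_site_measure:
  assumes d: "\<bar>d\<bar> = 1"
  shows "emeasure (site_measure p x) {S \<in> Pow (nbrs x). P (x + d \<in> S) (x - d \<in> S)}
    = ennreal (state_weight p P)"
proof -
  let ?f = "\<lambda>S. ennreal (p (card S) / real (2 choose card S))"
  have d': "d = 1 \<or> d = -1" using d by auto
  have N: "nbrs x = {x + d, x - d}" using d' by (auto simp: nbrs_def)
  have ne: "x + d \<noteq> x - d" using d' by auto
  have Pw: "Pow (nbrs x) = {{}, {x + d}, {x - d}, {x + d, x - d}}"
    unfolding N by (auto simp: Pow_insert)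
  have fin: "finite (Pow (nbrs x))" by (simp add: N)
  have f: "?f ({} :: int set) = ennreal (p 0)" "?f {x + d} = ennreal (p 1 / 2)"
      "?f {x - d} = ennreal (p 1 / 2)"
      "?f {x + d, x - d} = ennreal (p 2)"
    using ne by (simp_all add: numeral_2_eq_2)
  have "emeasure (site_measure p x) {S \<in> Pow (nbrs x). P (x + d \<in> S) (x - d \<in> S)}
    = (\<Sum>S | S \<in> Pow (nbrs x) \<and> P (x + d \<in> S) (x - d \<in> S). ?f S)"
    unfolding site_measure_def by (rule emeasure_point_measure_finite) (use fin in auto)
  also have "\<dots> = (\<Sum>S\<in>Pow (nbrs x). if P (x + d \<in> S) (x - d \<in> S) then ?f S else 0)"
    by (rule sum.inter_filter[OF fin])
  also have "\<dots> = (if P False False then ?f ({} :: int set) else 0) + (if P True False then ?f {x + d} else 0)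
      + (if P False True then ?f {x - d} else 0) + (if P True True then ?f {x + d, x - d} else 0)"
    unfolding Pw using ne by (simp add: doubleton_eq_iff add_ac)
  also have "\<dots> = ennreal (state_weight p P)"
    unfolding f state_weight_def using nonneg by (simp add: ennreal_plus[symmetric] del: ennreal_plus)
  finally show ?thesis .
qed

lemma prob_space_site_measure: "prob_space (site_measure p x)"
proof
  have "emeasure (site_measure p x) {S \<in> Pow (nbrs x). True} = ennreal (state_weight p (\<lambda>_ _. True))"
    using emeasure_site_measure[of 1 x "\<lambda>_ _. True"] by simp
  then show "emeasure (site_measure p x) (space (site_measure p x)) = 1"
    using total by (simp add: site_measure_def space_point_measure state_weight_def add_ac Pow_def)
qed

sublocale prob_space "config_measure p"
  unfolding config_measure_def by (intro prob_space_PiM prob_space_site_measure)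

abbreviation "M \<equiv> config_measure p"

lemma space_config: "\<omega> \<in> space M \<longleftrightarrow> (\<forall>x. \<omega> x \<subseteq> nbrs x)"
  by (auto simp: config_measure_def space_PiM site_measure_def space_point_measure PiE_iff)

lemma pred_mem [measurable]: "Measurable.pred M (\<lambda>\<omega>. y \<in> \<omega> x)"
  unfolding pred_def config_measure_def
  by (rule sets_Collect_single') (auto simp: site_measure_def space_point_measure sets_point_measure)

text \<open>Expanding the arbitrary connective \<open>c\<close> by its truth table turns the event
  into a finite Boolean combination of measurable ones.\<close>

lemma pred_connective:
  fixes c :: "bool \<Rightarrow> bool \<Rightarrow> bool"
  assumes [measurable]: "Measurable.pred M A" "Measurable.pred M B"
  shows "Measurable.pred M (\<lambda>\<omega>. c (A \<omega>) (B \<omega>))"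
proof -
  have "(\<lambda>\<omega>. c (A \<omega>) (B \<omega>)) = (\<lambda>\<omega>. (A \<omega> \<and> B \<omega> \<and> c True True) \<or> (A \<omega> \<and> \<not> B \<omega> \<and> c True False)
      \<or> (\<not> A \<omega> \<and> B \<omega> \<and> c False True) \<or> (\<not> A \<omega> \<and> \<not> B \<omega> \<and> c False False))"
    by (intro ext) (metis (full_types))
  then show ?thesis by simp
qed

lemma pred_ray_open [measurable]: "Measurable.pred M (ray_open c d n)"
proof -
  have [measurable]: "Measurable.pred M (\<lambda>\<omega>. (x, y) \<in> link c \<omega>)" for x y
    unfolding link_def by (simp add: pred_connective)
  show ?thesis unfolding ray_open_def[abs_def] by measurable
qed

text \<open>This is the form of independence used along a ray: \<open>x\<close> will be the next
  vertex and \<open>A\<close> an event about the vertices before it.\<close>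

lemma prob_indep_site:
  assumes d: "\<bar>d\<bar> = 1" and A [measurable]: "Measurable.pred M A"
    and inv: "\<And>\<omega> S. A \<omega> \<Longrightarrow> A (fun_upd \<omega> x S)"
  shows "prob {\<omega> \<in> space M. P (x + d \<in> \<omega> x) (x - d \<in> \<omega> x) \<and> A \<omega>}
    = state_weight p P * prob {\<omega> \<in> space M. A \<omega>}"
proof -
  let ?T = "{S \<in> Pow (nbrs x). P (x + d \<in> S) (x - d \<in> S)}"
  have sw: "state_weight p P \<ge> 0" using nonneg by (simp add: state_weight_def)
  have "{\<omega> \<in> space M. P (x + d \<in> \<omega> x) (x - d \<in> \<omega> x) \<and> A \<omega>}
      = {\<omega> \<in> space M. \<omega> x \<in> ?T} \<inter> {\<omega> \<in> space M. A \<omega>}"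
    by (auto simp: space_config)
  also have "emeasure M \<dots> = emeasure (site_measure p x) ?T * emeasure M {\<omega> \<in> space M. A \<omega>}"
    unfolding config_measure_def
  proof (rule emeasure_PiM_indep_coordinate)
    show "{\<omega> \<in> space (PiM UNIV (site_measure p)). A \<omega>} \<in> sets (PiM UNIV (site_measure p))"
      using A unfolding pred_def config_measure_def .
    show "fun_upd f x S \<in> {\<omega> \<in> space (PiM UNIV (site_measure p)). A \<omega>}"
      if "f \<in> {\<omega> \<in> space (PiM UNIV (site_measure p)). A \<omega>}" "S \<in> space (site_measure p x)" for f S
      using that inv by (auto simp: space_PiM PiE_iff)
  qed (simp_all add: prob_space_site_measure, auto simp: site_measure_def sets_point_measure)
  finally show ?thesis
    using sw unfolding emeasure_site_measure[OF d]
    by (simp add: emeasure_eq_measure ennreal_mult[symmetric])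
qed

section \<open>The recurrence along a ray\<close>

text \<open>With \<open>Q\<close> the identity or \<open>Not\<close> these are the sequences
  \<open>v\<close> and \<open>w\<close>. The forward bit of the tip is all that the next edge has to
  know about the past.\<close>

definition tip_prob :: "(bool \<Rightarrow> bool \<Rightarrow> bool) \<Rightarrow> int \<Rightarrow> (bool \<Rightarrow> bool) \<Rightarrow> nat \<Rightarrow> real" where
  "tip_prob c d Q n = prob {\<omega> \<in> space M. ray_open c d n \<omega> \<and> Q (d * int n + d \<in> \<omega> (d * int n))}"

lemma tip_prob_0:
  assumes "\<bar>d\<bar> = 1"
  shows "tip_prob c d Q 0 = state_weight p (\<lambda>f _. Q f)"
  using prob_indep_site[OF assms, of "\<lambda>_. True" 0 "\<lambda>f _. Q f"]
  by (simp add: tip_prob_def prob_space)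

text \<open>The new edge combines the forward bit of the old tip with the backward bit of the new
  vertex. Once the former is fixed, what remains is a condition on the new vertex alone, and its
  weight factors out by independence.\<close>

lemma tip_prob_Suc:
  assumes d: "\<bar>d\<bar> = 1"
  shows "tip_prob c d Q (Suc n) = state_weight p (\<lambda>f b. c True b \<and> Q f) * tip_prob c d (\<lambda>f. f) n
    + state_weight p (\<lambda>f b. c False b \<and> Q f) * tip_prob c d Not n"
proof -
  let ?x = "d * int (Suc n)"
  \<comment> \<open>The first conjunct reads only the new site \<open>?x\<close>, the rest only
    earlier sites; \<open>t\<close> is the value that \<open>R\<close> prescribes for the old tip's
    forward bit.\<close>
  let ?E = "\<lambda>t R \<omega>. (c t (?x - d \<in> \<omega> ?x) \<and> Q (?x + d \<in> \<omega> ?x))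
    \<and> ray_open c d n \<omega> \<and> R (d * int n + d \<in> \<omega> (d * int n))"
  have d0: "d \<noteq> 0" using d by auto
  have ne: "d * int k \<noteq> ?x" if "k \<le> n" for k using d0 that by auto
  \<comment> \<open>The first \<open>n\<close> edges of the ray involve the sites with index at most
    \<open>n\<close>, whereas \<open>?x\<close> has index \<open>Suc n\<close>.\<close>
  have inv: "ray_open c d n (fun_upd \<omega> ?x S) \<and>
      R (d * int n + d \<in> fun_upd \<omega> ?x S (d * int n))"
    if "ray_open c d n \<omega> \<and> R (d * int n + d \<in> \<omega> (d * int n))" for R \<omega> S
  proof -
    have "(d * int k, d * int k + d) \<in> link c (fun_upd \<omega> ?x S) \<longleftrightarrow>
        (d * int k, d * int k + d) \<in> link c \<omega>" if "k < n" for k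
      using that ne[of k] ne[of "Suc k"] by (simp add: link_def algebra_simps)
    then show ?thesis using that ne[of n] by (simp add: ray_open_def)
  qed
  have pr [measurable]: "Measurable.pred M (\<lambda>\<omega>. ray_open c d n \<omega> \<and> R (d * int n + d \<in> \<omega> (d * int n)))" for R
    using pred_connective[of "ray_open c d n" "\<lambda>\<omega>. d * int n + d \<in> \<omega> (d * int n)" "\<lambda>a b. a \<and> R b"] by simp
  have [measurable]: "Measurable.pred M (\<lambda>\<omega>. c t (?x - d \<in> \<omega> ?x) \<and> Q (?x + d \<in> \<omega> ?x))" for t
    using pred_connective[of "\<lambda>\<omega>. ?x - d \<in> \<omega> ?x" "\<lambda>\<omega>. ?x + d \<in> \<omega> ?x" "\<lambda>a b. c t a \<and> Q b"] by simp
  have eq: "prob {\<omega> \<in> space M. ?E t R \<omega>} = state_weight p (\<lambda>f b. c t b \<and> Q f) * tip_prob c d R n" for t R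
    unfolding tip_prob_def
    by (rule prob_indep_site[OF d pr inv, where P = "\<lambda>f b. c t b \<and> Q f"])
  have "{\<omega> \<in> space M. ray_open c d (Suc n) \<omega> \<and> Q (?x + d \<in> \<omega> ?x)}
      = {\<omega> \<in> space M. ?E True (\<lambda>f. f) \<omega>} \<union> {\<omega> \<in> space M. ?E False Not \<omega>}"
  proof (rule set_eqI)
    fix \<omega>
    have x: "?x - d = d * int n" "d * int n + d = ?x" by (simp_all add: algebra_simps)
    show "\<omega> \<in> {\<omega> \<in> space M. ray_open c d (Suc n) \<omega> \<and> Q (?x + d \<in> \<omega> ?x)}
      \<longleftrightarrow> \<omega> \<in> {\<omega> \<in> space M. ?E True (\<lambda>f. f) \<omega>} \<union> {\<omega> \<in> space M. ?E False Not \<omega>}"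
      unfolding x ray_open_Suc link_def
      by (cases "?x \<in> \<omega> (d * int n)") (auto simp del: of_nat_Suc)
  qed
  then have "tip_prob c d Q (Suc n)
      = prob ({\<omega> \<in> space M. ?E True (\<lambda>f. f) \<omega>} \<union> {\<omega> \<in> space M. ?E False Not \<omega>})"
    by (simp only: tip_prob_def)
  also have "\<dots> = prob {\<omega> \<in> space M. ?E True (\<lambda>f. f) \<omega>} + prob {\<omega> \<in> space M. ?E False Not \<omega>}"
    by (rule finite_measure_Union) (measurable, auto)
  finally show ?thesis using eq[of True "\<lambda>f. f"] eq[of False Not] by simp
qed

lemma prob_ray_open: "prob {\<omega> \<in> space M. ray_open c d n \<omega>} = tip_prob c d (\<lambda>f. f) n + tip_prob c d Not n"
  unfolding tip_prob_def
  by (subst finite_measure_Union[symmetric]) (measurable, auto intro!: arg_cong[where f = prob])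

text \<open>The two equations are first-step equations: \<alpha> and \<beta> play the role of the
  expected number of cluster vertices from the tip outwards, tip included, when the tip does or does
  not point forward. They say precisely that the potential drops by \<open>v + w\<close> per
  step.\<close>

lemma prob_ray_open_sums:
  assumes d: "\<bar>d\<bar> = 1" and pos: "\<alpha> \<ge> 0" "\<beta> \<ge> 0"
    and \<alpha>: "\<alpha> = 1 + \<alpha> * state_weight p (\<lambda>f b. c True b \<and> f) + \<beta> * state_weight p (\<lambda>f b. c True b \<and> \<not> f)"
    and \<beta>: "\<beta> = 1 + \<alpha> * state_weight p (\<lambda>f b. c False b \<and> f) + \<beta> * state_weight p (\<lambda>f b. c False b \<and> \<not> f)"
  shows "(\<lambda>n. prob {\<omega> \<in> space M. ray_open c d n \<omega>}) sums
    (\<alpha> * state_weight p (\<lambda>f _. f) + \<beta> * state_weight p (\<lambda>f _. \<not> f))"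
proof -
  let ?v = "tip_prob c d (\<lambda>f. f)" and ?w = "tip_prob c d Not"
  have "(\<lambda>n. ?v n + ?w n) sums (\<alpha> * ?v 0 + \<beta> * ?w 0)"
  proof (rule sums_telescoping_potential)
    fix n
    have a: "\<alpha> - 1 = \<alpha> * state_weight p (\<lambda>f b. c True b \<and> f) + \<beta> * state_weight p (\<lambda>f b. c True b \<and> \<not> f)"
      and b: "\<beta> - 1 = \<alpha> * state_weight p (\<lambda>f b. c False b \<and> f) + \<beta> * state_weight p (\<lambda>f b. c False b \<and> \<not> f)"
      using \<alpha> \<beta> by linarith+
    have "?v n + ?w n = \<alpha> * ?v n + \<beta> * ?w n - ((\<alpha> - 1) * ?v n + (\<beta> - 1) * ?w n)"
      by (simp add: algebra_simps)
    also have "(\<alpha> - 1) * ?v n + (\<beta> - 1) * ?w n = \<alpha> * ?v (Suc n) + \<beta> * ?w (Suc n)"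
      unfolding tip_prob_Suc[OF d] a b by (simp add: algebra_simps)
    finally show "?v n + ?w n = \<alpha> * ?v n + \<beta> * ?w n - (\<alpha> * ?v (Suc n) + \<beta> * ?w (Suc n))" .
  qed (auto simp: pos tip_prob_def)
  then show ?thesis by (simp add: prob_ray_open tip_prob_0[OF d])
qed

section \<open>From rays to the expected cluster size\<close>

text \<open>The size is a sum of indicators over the two rays, and integral and sum may be
  exchanged. Each full ray contributes \<open>s\<close>; the origin has probability 1 and is dropped
  from one of them, which gives \<open>s + (s - 1)\<close>.\<close>

lemma cluster_size_expectation:
  assumes c: "\<not> c False False"
    and sums: "\<And>d. \<bar>d\<bar> = 1 \<Longrightarrow> (\<lambda>n. prob {\<omega> \<in> space M. ray_open c d n \<omega>}) sums s"
  shows "(\<integral>\<^sup>+\<omega>. emeasure (count_space UNIV) {y. (0, y) \<in> (link c \<omega>)\<^sup>*} \<partial>M) = ennreal (2 * s - 1)"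
proof -
  have reach: "d * int n \<in> {y. (0, y) \<in> (link c \<omega>)\<^sup>*} \<longleftrightarrow> ray_open c d n \<omega>"
    if "\<omega> \<in> space M" "\<bar>d\<bar> = 1" for d n \<omega>
  proof -
    \<comment> \<open>Since \<open>c False False\<close> fails, a link needs at least one directed
      edge, and directed edges join neighbours only.\<close>
    have "\<bar>x - y\<bar> = 1" if "(x, y) \<in> link c \<omega>" for x y
    proof -
      have "y \<in> \<omega> x \<or> x \<in> \<omega> y" using that c by (auto simp: link_def) (metis (full_types))
      then show ?thesis using \<open>\<omega> \<in> space M\<close> by (force simp: space_config nbrs_def)
    qed
    from rtrancl_nearest_neighbour_iff[OF this \<open>\<bar>d\<bar> = 1\<close>]
    show ?thesis by (simp add: ray_open_def)
  qed
  \<comment> \<open>\<open>k = 0\<close> serves the ray with the origin, \<open>k = 1\<close> the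
    ray without it.\<close>
  have *: "(\<Sum>n. emeasure M {\<omega> \<in> space M. ray_open c d (n + k) \<omega>})
      = ennreal (s - (\<Sum>n<k. prob {\<omega> \<in> space M. ray_open c d n \<omega>}))" if "\<bar>d\<bar> = 1" for d k
    unfolding emeasure_eq_measure
    by (intro suminf_ennreal_eq sums_split_initial_segment sums that) simp
  have "(\<lambda>n. prob {\<omega> \<in> space M. ray_open c 1 (n + 1) \<omega>}) sums (s - 1)"
    using sums_split_initial_segment[OF sums[of 1], of 1] by (simp add: prob_space)
  \<comment> \<open>Since \<open>ennreal\<close> cuts negative numbers off at 0, merging the two ray
    sums at the end requires \<open>s - 1\<close> to be nonnegative.\<close>
  then have tail: "s - 1 \<ge> 0"
    by (rule sums_le[OF _ sums_zero, rotated]) simp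
  have "(\<integral>\<^sup>+\<omega>. emeasure (count_space UNIV) {y. (0, y) \<in> (link c \<omega>)\<^sup>*} \<partial>M) =
      (\<integral>\<^sup>+\<omega>. (\<Sum>n. indicator {\<omega> \<in> space M. ray_open c 1 n \<omega>} \<omega>)
        + (\<Sum>n. indicator {\<omega> \<in> space M. ray_open c (-1) (n + 1) \<omega>} \<omega>) \<partial>M)"
  proof (rule nn_integral_cong)
    fix \<omega> assume \<omega>: "\<omega> \<in> space M"
    have "indicator {y. (0, y) \<in> (link c \<omega>)\<^sup>*} (d * int n)
        = (indicator {\<omega> \<in> space M. ray_open c d n \<omega>} \<omega> :: ennreal)" if "\<bar>d\<bar> = 1" for d n
      unfolding indicator_def reach[OF \<omega> that] using \<omega> by simp
    from this[of 1] this[of "-1" "Suc _"]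
    show "emeasure (count_space UNIV) {y. (0, y) \<in> (link c \<omega>)\<^sup>*}
      = (\<Sum>n. indicator {\<omega> \<in> space M. ray_open c 1 n \<omega>} \<omega>)
        + (\<Sum>n. indicator {\<omega> \<in> space M. ray_open c (-1) (n + 1) \<omega>} \<omega>)"
      unfolding emeasure_count_space_int by (simp del: of_nat_Suc)
  qed
  also have "\<dots> = (\<Sum>n. emeasure M {\<omega> \<in> space M. ray_open c 1 n \<omega>})
      + (\<Sum>n. emeasure M {\<omega> \<in> space M. ray_open c (-1) (n + 1) \<omega>})"
    by (simp add: nn_integral_add nn_integral_suminf)
  also have "\<dots> = ennreal s + ennreal (s - 1)"
    using *[of 1 0] *[of "-1" 1] by (simp add: prob_space)
  also have "\<dots> = ennreal (2 * s - 1)"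
    using tail by (simp flip: ennreal_plus)
  finally show ?thesis .
qed

section \<open>Closed forms\<close>

lemma weak_susceptibility_eq:
  assumes "p 2 \<noteq> 1"
  shows "weak_susceptibility p = ennreal (8 * (1 + p 0) / (2 * p 0 + p 1)\<^sup>2 - 3)"
proof -
  \<comment> \<open>\<open>q\<close> is the probability that a given directed edge is absent; it is
    positive because \<open>p 2\<close> is not 1.\<close>
  define q where "q = p 0 + p 1 / 2"
  have q: "q > 0" using nonneg total assms by (auto simp: q_def)
  have p2: "p 2 = 1 + p 0 - 2 * q" and p1: "p (Suc 0) = 2 * q - 2 * p 0" using total by (auto simp: q_def)
  \<comment> \<open>From a tip that points forward the next edge is always open, so \<alpha> = 1 +
    \<alpha> (1 - q) + \<beta> q, that is, \<alpha> - \<beta> = 1/q. Substituting this into \<beta>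
    = 1 + \<alpha> \<open>p 2\<close> + \<beta> \<open>p 1 / 2\<close> gives q \<beta> = 1 +
    \<open>p 2\<close> / q.\<close>
  define \<beta> where "\<beta> = (1 + p 2 / q) / q"
  define \<alpha> where "\<alpha> = \<beta> + 1 / q"
  define s where "s = \<alpha> * (1 - q) + \<beta> * q"
  have "(\<lambda>n. prob {\<omega> \<in> space M. ray_open (\<or>) d n \<omega>}) sums s" if d: "\<bar>d\<bar> = 1" for d
  proof -
    have "(\<lambda>n. prob {\<omega> \<in> space M. ray_open (\<or>) d n \<omega>}) sums
        (\<alpha> * state_weight p (\<lambda>f _. f) + \<beta> * state_weight p (\<lambda>f _. \<not> f))"
    proof (rule prob_ray_open_sums[OF d])
      show "\<alpha> \<ge> 0" "\<beta> \<ge> 0" using q nonneg by (simp_all add: \<alpha>_def \<beta>_def)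
    qed (use q in \<open>simp_all add: state_weight_def \<alpha>_def \<beta>_def p1 p2 field_simps power2_eq_square\<close>)
    moreover have "state_weight p (\<lambda>f _. f) = 1 - q" "state_weight p (\<lambda>f _. \<not> f) = q"
      by (simp_all add: state_weight_def p1 p2 field_simps)
    ultimately show ?thesis by (simp add: s_def)
  qed
  then have "weak_susceptibility p = ennreal (2 * s - 1)"
    unfolding weak_susceptibility_def weak_cluster_link by (intro cluster_size_expectation) auto
  also have "2 * s - 1 = 8 * (1 + p 0) / (2 * p 0 + p 1)\<^sup>2 - 3"
    using q by (simp add: s_def \<alpha>_def \<beta>_def p1 p2 field_simps power2_eq_square)
  finally show ?thesis .
qed

lemma strong_susceptibility_eq:
  assumes "p 2 \<noteq> 1"
  shows "strong_susceptibility p = ennreal ((2 * p 2 + p 1)\<^sup>2 / (2 * (1 - p 2)) + 1)"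
proof -
  have p2: "p 2 < 1" using nonneg total assms by auto
  have p0: "p 0 = 1 - p (Suc 0) - p 2" using total by auto
  \<comment> \<open>A tip that does not point forward ends the ray, so \<beta> = 1, and \<alpha>
    solves \<alpha> = 1 + \<alpha> \<open>p 2\<close> + \<open>p 1 / 2\<close>.\<close>
  define \<alpha> where "\<alpha> = (1 + p 1 / 2) / (1 - p 2)"
  define s where "s = \<alpha> * (p 2 + p 1 / 2) + (p 0 + p 1 / 2)"
  have "(\<lambda>n. prob {\<omega> \<in> space M. ray_open (\<and>) d n \<omega>}) sums s" if d: "\<bar>d\<bar> = 1" for d
  proof -
    have "(\<lambda>n. prob {\<omega> \<in> space M. ray_open (\<and>) d n \<omega>}) sums
        (\<alpha> * state_weight p (\<lambda>f _. f) + 1 * state_weight p (\<lambda>f _. \<not> f))"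
    proof (rule prob_ray_open_sums[OF d])
      show "\<alpha> \<ge> 0" using p2 nonneg by (simp add: \<alpha>_def)
    qed (use p2 in \<open>simp_all add: state_weight_def \<alpha>_def field_simps\<close>)
    then show ?thesis by (simp add: s_def state_weight_def algebra_simps)
  qed
  then have "strong_susceptibility p = ennreal (2 * s - 1)"
    unfolding strong_susceptibility_def strong_cluster_link by (intro cluster_size_expectation) auto
  also have "2 * s - 1 = (2 * p 2 + p 1)\<^sup>2 / (2 * (1 - p 2)) + 1"
    using p2 by (simp add: s_def \<alpha>_def p0 field_simps power2_eq_square)
  finally show ?thesis .
qed

end

theorem theorem1:
  fixes p :: "nat \<Rightarrow> real"
  assumes "p 0 \<ge> 0" and "p 1 \<ge> 0" and "p 2 \<ge> 0"
    and "p 0 + p 1 + p 2 = 1"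
    and "p 2 \<noteq> 1"
  shows "weak_susceptibility p = ennreal (8 * (1 + p 0) / (2 * p 0 + p 1)\<^sup>2 - 3) \<and>
         strong_susceptibility p = ennreal ((2 * p 2 + p 1)\<^sup>2 / (2 * (1 - p 2)) + 1)"
proof -
  interpret site_percolation p using assms by unfold_locales
  show ?thesis using assms weak_susceptibility_eq strong_susceptibility_eq by blast
qed

end
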